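(* Let the symbol $\int_a^b$ denote throughout one fixed choice among the Kurzweil-Stieltjes, Young and Dushnik integrals; the following holds for each of these three choices. Let $f,g:[a,b]\to\mathbb{R}$ and $g_n:[a,b]\to\mathbb{R}$, $n\in\mathbb{N}$, be such that the integrals $\int_a^b f\,\mathrm{d}g_n$ exist for all $n\in\mathbb{N}$. Suppose that at least one of the following conditions is satisfied: (i) $f$ has bounded variation on $[a,b]$ and $g_n\to g$ uniformly on $[a,b]$; (ii) $f$ is bounded on $[a,b]$ and $\lim_{n\to\infty}\mathrm{var}_a^b(g_n-g)=0$. Then the integral $\int_a^b f\,\mathrm{d}g$ exists as well, and $$\lim_{n\to\infty}\int_a^b f\,\mathrm{d}g_n=\int_a^b f\,\mathrm{d}g .$$
   Context: Here $-\infty<a<b<\infty$. A function $h:[a,b]\to\mathbb{R}$ is regulated if it has finite one-sided limits $h(t-)=\lim_{\tau\to t-}h(\tau)$ for all $t\in(a,b]$ and $h(s+)=\lim_{\tau\to s+}h(\tau)$ for all $s\in[a,b)$. For regulated $h$ put $\Delta^-h(t)=h(t)-h(t-)$ for $t\in(a,b]$ and $\Delta^+h(s)=h(s+)-h(s)$ for $s\in[a,b)$. The symbol $\mathrm{var}_a^b\,h\in[0,\infty]$ is the total variation of $h$ on $[a,b]$. A division of $[a,b]$ is a finite sequence $\alpha=\{\alpha_0,\dots,\alpha_\nu\}$ with $a=\alpha_0<\alpha_1<\dots<\alpha_\nu=b$. A partition of $[a,b]$ is a pair $P=(\alpha,\xi)$ where $\alpha$ is a division of $[a,b]$ and $\xi=\{\xi_1,\dots,\xi_\nu\}$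 satisfies $\xi_j\in[\alpha_{j-1},\alpha_j]$ for all $j$. For divisions, $\alpha\supset\beta$ means inclusion of the sets of points. For $f,g:[a,b]\to\mathbb{R}$ and a partition $P=(\alpha,\xi)$ put $$S(f,\mathrm{d}g,P)=\sum_{j=1}^{\nu}f(\xi_j)\,[g(\alpha_j)-g(\alpha_{j-1})],$$ and, if $g$ is regulated, $$S_Y(f,\mathrm{d}g,P)=\sum_{j=1}^{\nu}\Big(f(\alpha_{j-1})\,\Delta^+g(\alpha_{j-1})+f(\xi_j)\,[g(\alpha_j-)-g(\alpha_{j-1}+)]+f(\alpha_j)\,\Delta^-g(\alpha_j)\Big).$$ Young integral and Dushnik integral: $(\mathrm{Y})\int_a^b f\,\mathrm{d}g$ (respectively $(\mathrm{D})\int_a^b f\,\mathrm{d}g$) exists and equals $I\in\mathbb{R}$ if for every $\varepsilon>0$ there is a division $\alpha_\varepsilon$ of $[a,b]$ such that $|S_Y(f,\mathrm{d}g,P)-I|<\varepsilon$ (respectively $|S(f,\mathrm{d}g,P)-I|<\varepsilon$) for all partitions $P=(\alpha,\xi)$ of $[a,b]$ with $\alpha\supset\alpha_\varepsilon$ and $\alpha_{j-1}<\xi_j<\alpha_j$ for all $j$. The Young integral is defined only for regulated integrators; existence of a Young integral with respect to a function includes that this function is regulated. Kurzweil-Stieltjes integral: $(\mathrm{K})\int_a^b f\,\mathrm{d}g$ exists and equals $I\in\mathbb{R}$ if for every $\varepsilon>0$ there is a function $\delta_\varepsilon:[a,b]\to(0,1)$ such that $|S(f,\mathrm{d}g,P)-I|<\varepsilon$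 for all partitions $P=(\alpha,\xi)$ of $[a,b]$ with $[\alpha_{j-1},\alpha_j]\subset[\xi_j-\delta_\varepsilon(\xi_j),\xi_j+\delta_\varepsilon(\xi_j)]$ for all $j$. *)

theory Defs
  imports "HOL-Analysis.Analysis"
begin

text \<open>
  Functions on \<open>[a,b]\<close> are represented by total functions on the reals. For \<open>a < b\<close> every notion
  below depends only on their values in \<open>[a,b]\<close>: the filters \<open>at_left t\<close> and \<open>at_right s\<close> are
  used only for \<open>t \<in> (a,b]\<close> and \<open>s \<in> [a,b)\<close>, so the limits agree with those taken within \<open>[a,b]\<close>.
\<close>

definition regulated_on :: "real \<Rightarrow> real \<Rightarrow> (real \<Rightarrow> real) \<Rightarrow> bool" where
  "regulated_on a b h \<longleftrightarrow>
     (\<forall>t\<in>{a<..b}. \<exists>l. (h \<longlongrightarrow> l) (at_left t)) \<and>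
     (\<forall>s\<in>{a..<b}. \<exists>l. (h \<longlongrightarrow> l) (at_right s))"

definition left_lim :: "(real \<Rightarrow> real) \<Rightarrow> real \<Rightarrow> real" where
  "left_lim h t = Lim (at_left t) h"

definition right_lim :: "(real \<Rightarrow> real) \<Rightarrow> real \<Rightarrow> real" where
  "right_lim h s = Lim (at_right s) h"

definition left_jump :: "(real \<Rightarrow> real) \<Rightarrow> real \<Rightarrow> real" where
  "left_jump h t = h t - left_lim h t"

definition right_jump :: "(real \<Rightarrow> real) \<Rightarrow> real \<Rightarrow> real" where
  "right_jump h s = right_lim h s - h s"

text \<open>
  A division with \<open>\<nu>\<close> subintervals is given by \<open>\<nu>\<close> and the points \<open>\<alpha> 0, \<dots>, \<alpha> \<nu>\<close>; its tags are
  \<open>\<xi> 1, \<dots>, \<xi> \<nu>\<close>. Values of \<open>\<alpha>\<close> and \<open>\<xi>\<close> at other indices are irrelevant.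
\<close>

definition is_division :: "real \<Rightarrow> real \<Rightarrow> nat \<Rightarrow> (nat \<Rightarrow> real) \<Rightarrow> bool" where
  "is_division a b \<nu> \<alpha> \<longleftrightarrow>
     \<alpha> 0 = a \<and> \<alpha> \<nu> = b \<and> (\<forall>j\<in>{1..\<nu>}. \<alpha> (j - 1) < \<alpha> j)"

definition division_points :: "nat \<Rightarrow> (nat \<Rightarrow> real) \<Rightarrow> real set" where
  "division_points \<nu> \<alpha> = \<alpha> ` {0..\<nu>}"

definition is_partition ::
  "real \<Rightarrow> real \<Rightarrow> nat \<Rightarrow> (nat \<Rightarrow> real) \<Rightarrow> (nat \<Rightarrow> real) \<Rightarrow> bool" where
  "is_partition a b \<nu> \<alpha> \<xi> \<longleftrightarrow>
     is_division a b \<nu> \<alpha> \<and> (\<forall>j\<in>{1..\<nu>}. \<xi> j \<in> {\<alpha> (j - 1)..\<alpha> j})"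

definition total_variation :: "real \<Rightarrow> real \<Rightarrow> (real \<Rightarrow> real) \<Rightarrow> ennreal" where
  "total_variation a b h =
     Sup {ennreal (\<Sum>j=1..\<nu>. \<bar>h (\<alpha> j) - h (\<alpha> (j - 1))\<bar>) | \<nu> \<alpha>. is_division a b \<nu> \<alpha>}"

definition bounded_variation_on :: "real \<Rightarrow> real \<Rightarrow> (real \<Rightarrow> real) \<Rightarrow> bool" where
  "bounded_variation_on a b h \<longleftrightarrow> total_variation a b h < \<infinity>"

definition S_sum ::
  "(real \<Rightarrow> real) \<Rightarrow> (real \<Rightarrow> real) \<Rightarrow> nat \<Rightarrow> (nat \<Rightarrow> real) \<Rightarrow> (nat \<Rightarrow> real) \<Rightarrow> real" where
  "S_sum f g \<nu> \<alpha> \<xi> = (\<Sum>j=1..\<nu>. f (\<xi> j) * (g (\<alpha> j) - g (\<alpha> (j - 1))))"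

definition SY_sum ::
  "(real \<Rightarrow> real) \<Rightarrow> (real \<Rightarrow> real) \<Rightarrow> nat \<Rightarrow> (nat \<Rightarrow> real) \<Rightarrow> (nat \<Rightarrow> real) \<Rightarrow> real" where
  "SY_sum f g \<nu> \<alpha> \<xi> =
     (\<Sum>j=1..\<nu>. f (\<alpha> (j - 1)) * right_jump g (\<alpha> (j - 1))
              + f (\<xi> j) * (left_lim g (\<alpha> j) - right_lim g (\<alpha> (j - 1)))
              + f (\<alpha> j) * left_jump g (\<alpha> j))"

definition has_Kurzweil_integral ::
  "real \<Rightarrow> real \<Rightarrow> (real \<Rightarrow> real) \<Rightarrow> (real \<Rightarrow> real) \<Rightarrow> real \<Rightarrow> bool" where
  "has_Kurzweil_integral a b f g I \<longleftrightarrow>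
     (\<forall>\<epsilon>>0. \<exists>\<delta>::real \<Rightarrow> real. (\<forall>t\<in>{a..b}. 0 < \<delta> t \<and> \<delta> t < 1) \<and>
        (\<forall>\<nu> \<alpha> \<xi>. is_partition a b \<nu> \<alpha> \<xi> \<and>
            (\<forall>j\<in>{1..\<nu>}. {\<alpha> (j - 1)..\<alpha> j} \<subseteq> {\<xi> j - \<delta> (\<xi> j)..\<xi> j + \<delta> (\<xi> j)})
           \<longrightarrow> \<bar>S_sum f g \<nu> \<alpha> \<xi> - I\<bar> < \<epsilon>))"

definition has_Young_integral ::
  "real \<Rightarrow> real \<Rightarrow> (real \<Rightarrow> real) \<Rightarrow> (real \<Rightarrow> real) \<Rightarrow> real \<Rightarrow> bool" where
  "has_Young_integral a b f g I \<longleftrightarrow> regulated_on a b g \<and>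
     (\<forall>\<epsilon>>0. \<exists>\<mu> \<beta>. is_division a b \<mu> \<beta> \<and>
        (\<forall>\<nu> \<alpha> \<xi>. is_partition a b \<nu> \<alpha> \<xi> \<and>
            division_points \<mu> \<beta> \<subseteq> division_points \<nu> \<alpha> \<and>
            (\<forall>j\<in>{1..\<nu>}. \<alpha> (j - 1) < \<xi> j \<and> \<xi> j < \<alpha> j)
           \<longrightarrow> \<bar>SY_sum f g \<nu> \<alpha> \<xi> - I\<bar> < \<epsilon>))"

definition has_Dushnik_integral ::
  "real \<Rightarrow> real \<Rightarrow> (real \<Rightarrow> real) \<Rightarrow> (real \<Rightarrow> real) \<Rightarrow> real \<Rightarrow> bool" where
  "has_Dushnik_integral a b f g I \<longleftrightarrow>
     (\<forall>\<epsilon>>0. \<exists>\<mu> \<beta>. is_division a b \<mu> \<beta> \<and>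
        (\<forall>\<nu> \<alpha> \<xi>. is_partition a b \<nu> \<alpha> \<xi> \<and>
            division_points \<mu> \<beta> \<subseteq> division_points \<nu> \<alpha> \<and>
            (\<forall>j\<in>{1..\<nu>}. \<alpha> (j - 1) < \<xi> j \<and> \<xi> j < \<alpha> j)
           \<longrightarrow> \<bar>S_sum f g \<nu> \<alpha> \<xi> - I\<bar> < \<epsilon>))"

datatype integral_kind = Kurzweil | Young | Dushnik

fun has_stieltjes_integral ::
  "integral_kind \<Rightarrow> real \<Rightarrow> real \<Rightarrow> (real \<Rightarrow> real) \<Rightarrow> (real \<Rightarrow> real) \<Rightarrow> real \<Rightarrow> bool" where
  "has_stieltjes_integral Kurzweil a b f g I = has_Kurzweil_integral a b f g I"
| "has_stieltjes_integral Young a b f g I = has_Young_integral a b f g I"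
| "has_stieltjes_integral Dushnik a b f g I = has_Dushnik_integral a b f g I"

definition stieltjes_integrable ::
  "integral_kind \<Rightarrow> real \<Rightarrow> real \<Rightarrow> (real \<Rightarrow> real) \<Rightarrow> (real \<Rightarrow> real) \<Rightarrow> bool" where
  "stieltjes_integrable K a b f g \<longleftrightarrow> (\<exists>I. has_stieltjes_integral K a b f g I)"

text \<open>
  For \<open>a < b\<close> the value is unique: admissible partitions always exist (by Cousin's lemma for the
  Kurzweil kind), and two gauges or two divisions have a common refinement. The value is
  unspecified if the integral does not exist.
\<close>

definition stieltjes_integral ::
  "integral_kind \<Rightarrow> real \<Rightarrow> real \<Rightarrow> (real \<Rightarrow> real) \<Rightarrow> (real \<Rightarrow> real) \<Rightarrow> real" where
  "stieltjes_integral K a b f g = (THE I. has_stieltjes_integral K a b f g I)"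

end

theory Submission
  imports Defs
begin

text \<open>
  Each of the three integrals is a limit along a proper filter of partitions. In both cases
  \<open>S(f, dg\<^sub>n, P) - S(f, dg, P)\<close> tends to \<open>0\<close> uniformly in \<open>P\<close>: in case (i) by summation by parts,
  in case (ii) directly. The same bound holds for Young sums, as these are limits of ordinary
  sums. Completeness then allows the limits in \<open>n\<close> and along the filter to be interchanged.
\<close>

text \<open>Ordinary sums are linear in the integrator, so the estimates concern sums for
  \<open>h = gn - g\<close>. In case (i) only the size of \<open>h\<close> is controlled, not its
  variation, so the increments must be moved onto \<open>f\<close>, whose variation is then taken
  along the tags. The Young integral shapes the rest. Its existence demands a regulated
  \<open>g\<close>, which is itself a claim about the limit; it follows from the same interchange of
  limits, taken along one-sided neighbourhoods of a point instead of partitions. Estimating Young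
  sums directly would repeat the summation by parts with one-sided limits in it. Approximation by
  ordinary sums avoids this, provided that the uniform bounds are non-strict, so that they survive
  the limit.\<close>

text \<open>A Moore-Osgood argument: \<open>l m\<close> and \<open>l n\<close> are both compared
  with \<open>v\<close> along \<open>F\<close>, which says something about them because
  \<open>F\<close> is proper. How far along \<open>F\<close> the closeness sets in may depend on
  \<open>n\<close>.\<close>

lemma interchange_limits:
  fixes u :: "nat \<Rightarrow> 'p \<Rightarrow> 'm::complete_space" and v :: "'p \<Rightarrow> 'm"
  assumes F: "F \<noteq> bot"
    and u: "\<And>n. (u n \<longlongrightarrow> l n) F"
    and close: "\<And>e. e > 0 \<Longrightarrow> \<forall>\<^sub>F n in sequentially. \<forall>\<^sub>F p in F. dist (u n p) (v p) \<le> e"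
  shows "\<exists>L. l \<longlonglongrightarrow> L \<and> (v \<longlongrightarrow> L) F"
proof -
  have "Cauchy l"
  proof (rule metric_CauchyI)
    fix e :: real assume "e > 0"
    then obtain N where N: "\<And>n. n \<ge> N \<Longrightarrow> \<forall>\<^sub>F p in F. dist (u n p) (v p) \<le> e / 3"
      using close[of "e / 3"] by (auto simp: eventually_sequentially)
    have "dist (l m) (l n) < e" if "m \<ge> N" "n \<ge> N" for m n
    proof -
      have "\<forall>\<^sub>F p in F. dist (u m p) (u n p) \<le> 2 * e / 3"
        using N[OF that(1)] N[OF that(2)]
      proof eventually_elim
        case (elim p)
        then show ?case using dist_triangle2[of "u m p" "u n p" "v p"] by simp
      qed
      then have "dist (l m) (l n) \<le> 2 * e / 3"
        using tendsto_upperbound[OF tendsto_dist[OF u u] _ F] by blast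
      then show ?thesis using \<open>e > 0\<close> by simp
    qed
    then show "\<exists>N. \<forall>m\<ge>N. \<forall>n\<ge>N. dist (l m) (l n) < e" by blast
  qed
  then obtain L where L: "l \<longlonglongrightarrow> L" by (auto simp: Cauchy_convergent_iff convergent_def)
  have "(v \<longlongrightarrow> L) F"
  proof (rule tendstoI)
    fix e :: real assume "e > 0"
    then have "\<forall>\<^sub>F n in sequentially. dist (l n) L < e / 3 \<and> (\<forall>\<^sub>F p in F. dist (u n p) (v p) \<le> e / 3)"
      using tendstoD[OF L, of "e / 3"] close[of "e / 3"] by (auto intro: eventually_conj)
    then obtain n where n: "dist (l n) L < e / 3" "\<forall>\<^sub>F p in F. dist (u n p) (v p) \<le> e / 3"
      by (auto simp: eventually_sequentially)
    have "\<forall>\<^sub>F p in F. dist (u n p) (l n) < e / 3"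
      by (rule tendstoD[OF u]) (use \<open>e > 0\<close> in simp)
    with n(2) show "\<forall>\<^sub>F p in F. dist (v p) L < e"
    proof eventually_elim
      case (elim p)
      then show ?case
        using n(1) dist_triangle3[of "v p" "l n" "u n p"] dist_triangle[of "v p" L "l n"]
        by (simp add: dist_commute)
    qed
  qed
  with L show ?thesis by blast
qed

subsection \<open>Divisions and partitions\<close>

lemma is_division_mono:
  assumes "is_division a b \<nu> \<alpha>" "i \<le> j" "j \<le> \<nu>"
  shows "\<alpha> i \<le> \<alpha> j"
  using assms(2,3)
proof (induction j rule: dec_induct)
  case (step n)
  then have "\<alpha> n < \<alpha> (Suc n)"
    using assms(1) by (auto simp: is_division_def dest!: bspec[of _ _ "Suc n"])
  then show ?case using step by simp
qed simp

lemma is_division_bounds: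
  assumes "is_division a b \<nu> \<alpha>" "j \<le> \<nu>"
  shows "\<alpha> j \<in> {a..b}"
  using is_division_mono[OF assms(1), of 0 j] is_division_mono[OF assms(1), of j \<nu>] assms
  by (auto simp: is_division_def)

text \<open>Divisions are grown at the right end, starting from the division of
  \<open>[a, a]\<close> with no subinterval. This is the step of all later constructions of
  divisions and partitions, which is why the right endpoint is a variable.\<close>

lemma is_division_extend:
  assumes "is_division a c \<nu> \<alpha>" "c < d"
  shows "is_division a d (Suc \<nu>) (\<alpha>(Suc \<nu> := d))"
  using assms by (auto simp: is_division_def atLeastAtMostSuc_conv)

lemma is_partition_extend:
  assumes "is_partition a c \<nu> \<alpha> \<xi>" "c < d" "s \<in> {c..d}"
  shows "is_partition a d (Suc \<nu>) (\<alpha>(Suc \<nu> := d)) (\<xi>(Suc \<nu> := s))"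
proof -
  have "\<alpha> \<nu> = c" using assms(1) by (simp add: is_partition_def is_division_def)
  then show ?thesis
    using assms is_division_extend[of a c \<nu> \<alpha> d]
    by (auto simp: is_partition_def atLeastAtMostSuc_conv)
qed

lemma S_sum_extend:
  assumes "is_partition a c \<nu> \<alpha> \<xi>"
  shows "S_sum f g (Suc \<nu>) (\<alpha>(Suc \<nu> := d)) (\<xi>(Suc \<nu> := s))
    = S_sum f g \<nu> \<alpha> \<xi> + f s * (g d - g c)"
proof -
  have "\<alpha> \<nu> = c" using assms by (simp add: is_partition_def is_division_def)
  moreover have "(\<Sum>j=1..\<nu>. f ((\<xi>(Suc \<nu> := s)) j) *
      (g ((\<alpha>(Suc \<nu> := d)) j) - g ((\<alpha>(Suc \<nu> := d)) (j - 1)))) = S_sum f g \<nu> \<alpha> \<xi>"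
    unfolding S_sum_def by (intro sum.cong) auto
  ultimately show ?thesis by (simp add: S_sum_def)
qed

lemma division_through_finite_set:
  assumes "finite D" "D \<subseteq> {a..b}" "a \<le> b"
  shows "\<exists>\<nu> \<alpha>. is_division a b \<nu> \<alpha> \<and> D \<subseteq> division_points \<nu> \<alpha>"
proof -
  \<comment> \<open>The induction adds a new largest point each time, so the right endpoint has to
    move with \<open>E\<close>; inserting \<open>a\<close> covers the empty set. Applied to
    \<open>insert b D\<close>, the endpoint is \<open>b\<close>.\<close>
  have "E \<subseteq> {a..} \<Longrightarrow> \<exists>\<nu> \<alpha>. is_division a (Max (insert a E)) \<nu> \<alpha> \<and> E \<subseteq> division_points \<nu> \<alpha>"
    if "finite E" for E :: "real set"
    using that
  proof (induction E rule: finite_linorder_max_induct)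
    case empty
    have "is_division a a 0 (\<lambda>_. a)" by (simp add: is_division_def)
    then show ?case by auto
  next
    case (insert d E)
    then obtain \<nu> \<alpha> where *: "is_division a (Max (insert a E)) \<nu> \<alpha>" "E \<subseteq> division_points \<nu> \<alpha>"
      by auto
    have ad: "a \<le> d" using insert.prems by simp
    have "Max (insert a E) \<le> d" using insert ad by (auto intro: less_imp_le)
    then have d: "Max (insert a (insert d E)) = d"
      using insert.hyps ad by (intro Max_eqI) (auto intro: less_imp_le)
    show ?case
    proof (cases "Max (insert a E) = d")
      \<comment> \<open>As \<open>d\<close> exceeds all of \<open>E\<close>, this happens only for
        \<open>d = a\<close>, which is already a division point; appending it would violate strict
        monotonicity.\<close>
      case True
      then have "\<alpha> \<nu> = d" using *(1) by (simp add: is_division_def)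
      then have "d \<in> division_points \<nu> \<alpha>" by (auto simp: division_points_def)
      then show ?thesis using * d True by auto
    next
      case False
      then have "is_division a d (Suc \<nu>) (\<alpha>(Suc \<nu> := d))"
        using is_division_extend[OF *(1)] \<open>Max (insert a E) \<le> d\<close> by simp
      moreover have "insert d E \<subseteq> division_points (Suc \<nu>) (\<alpha>(Suc \<nu> := d))"
        using *(2) by (auto simp: division_points_def image_iff Bex_def subset_iff) (metis Suc_n_not_le_n le_SucI)
      ultimately show ?thesis using d by metis
    qed
  qed
  moreover have "insert b D \<subseteq> {a..}" using assms by auto
  moreover have "Max (insert a (insert b D)) = b" by (rule Max_eqI) (use assms in auto)
  ultimately show ?thesis using \<open>finite D\<close> by (metis finite_insert insert_subset)
qed

lemma sum_le_total_variation:
  assumes t: "\<And>j. j < n \<Longrightarrow> t j \<le> t (Suc j)" "t 0 = a" "t n = b"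
  shows "ennreal (\<Sum>j<n. \<bar>h (t (Suc j)) - h (t j)\<bar>) \<le> total_variation a b h"
proof -
  have "\<exists>\<nu> \<alpha>. is_division a (t m) \<nu> \<alpha> \<and>
      (\<Sum>j=1..\<nu>. \<bar>h (\<alpha> j) - h (\<alpha> (j - 1))\<bar>) = (\<Sum>j<m. \<bar>h (t (Suc j)) - h (t j)\<bar>)"
    if "m \<le> n" for m
    using that
  proof (induction m)
    case 0
    have "is_division a a 0 (\<lambda>_. a)" by (simp add: is_division_def)
    then show ?case using t(2) by (intro exI[of _ 0] exI[of _ "\<lambda>_. a"]) simp
  next
    case (Suc m)
    then obtain \<nu> \<alpha> where *: "is_division a (t m) \<nu> \<alpha>"
      "(\<Sum>j=1..\<nu>. \<bar>h (\<alpha> j) - h (\<alpha> (j - 1))\<bar>) = (\<Sum>j<m. \<bar>h (t (Suc j)) - h (t j)\<bar>)"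
      by auto
    show ?case
    proof (cases "t (Suc m) = t m")
      case True
      then show ?thesis using * by auto
    next
      case False
      let ?\<alpha> = "\<alpha>(Suc \<nu> := t (Suc m))"
      have "is_division a (t (Suc m)) (Suc \<nu>) ?\<alpha>"
        using False t(1)[of m] Suc.prems by (intro is_division_extend[OF *(1)]) auto
      moreover have "(\<Sum>j=1..Suc \<nu>. \<bar>h (?\<alpha> j) - h (?\<alpha> (j - 1))\<bar>)
          = (\<Sum>j<Suc m. \<bar>h (t (Suc j)) - h (t j)\<bar>)"
      proof -
        have "(\<Sum>j=1..\<nu>. \<bar>h (?\<alpha> j) - h (?\<alpha> (j - 1))\<bar>) = (\<Sum>j=1..\<nu>. \<bar>h (\<alpha> j) - h (\<alpha> (j - 1))\<bar>)"
          by (intro sum.cong) auto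
        moreover have "\<alpha> \<nu> = t m" using *(1) by (simp add: is_division_def)
        ultimately show ?thesis using *(2) by simp
      qed
      ultimately show ?thesis by blast
    qed
  qed
  from this[of n] t(3) obtain \<nu> \<alpha> where "is_division a b \<nu> \<alpha>"
    "(\<Sum>j=1..\<nu>. \<bar>h (\<alpha> j) - h (\<alpha> (j - 1))\<bar>) = (\<Sum>j<n. \<bar>h (t (Suc j)) - h (t j)\<bar>)"
    by auto
  then show ?thesis
    unfolding total_variation_def by (intro Sup_upper) (auto intro!: exI[of _ \<nu>] exI[of _ \<alpha>])
qed

subsection \<open>Estimates for Riemann-Stieltjes sums\<close>

text \<open>The left side involves only \<open>F 1, ..., F n\<close>, so \<open>F 0\<close> and
  \<open>F (Suc n)\<close> are free; they will be the values of \<open>f\<close> at the two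
  endpoints.\<close>

lemma summation_by_parts_tags:
  fixes F u :: "nat \<Rightarrow> real"
  shows "(\<Sum>j<n. F (Suc j) * (u (Suc j) - u j))
    = F (Suc n) * u n - F 0 * u 0 - (\<Sum>j<Suc n. u j * (F (Suc j) - F j))"
  by (induction n) (simp_all add: algebra_simps)

text \<open>Summation by parts turns the sum into two boundary terms, bounded by
  \<open>\<bar>f a\<bar> * c\<close> and \<open>\<bar>f b\<bar> * c\<close>, and a sum of increments
  of \<open>f\<close> between consecutive tags, weighted by values of \<open>h\<close>.\<close>

lemma S_sum_bound_bounded_variation:
  assumes P: "is_partition a b \<nu> \<alpha> \<xi>"
    and V: "total_variation a b f \<le> ennreal V" "V \<ge> 0"
    and h: "\<And>x. x \<in> {a..b} \<Longrightarrow> \<bar>h x\<bar> \<le> c"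
  shows "\<bar>S_sum f h \<nu> \<alpha> \<xi>\<bar> \<le> (\<bar>f a\<bar> + \<bar>f b\<bar> + V) * c"
proof -
  have div: "is_division a b \<nu> \<alpha>" using P by (simp add: is_partition_def)
  have ends: "\<alpha> 0 = a" "\<alpha> \<nu> = b" using div by (auto simp: is_division_def)
  have \<xi>: "\<alpha> j \<le> \<xi> (Suc j) \<and> \<xi> (Suc j) \<le> \<alpha> (Suc j)" if "j < \<nu>" for j
    using P that by (auto simp: is_partition_def dest!: bspec[of _ _ "Suc j"])
  \<comment> \<open>The tags framed by the endpoints: \<open>t 0 = a\<close> and
    \<open>t (Suc \<nu>) = b\<close>. They interlace with the division,
    \<open>t j \<le> \<alpha> j \<le> t (Suc j)\<close>, which makes \<open>t\<close>
    monotone.\<close>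
  define t where "t j = (if j = 0 then a else if \<nu> < j then b else \<xi> j)" for j
  have t_le: "t j \<le> \<alpha> j" if "j \<le> \<nu>" for j
    using that \<xi>[of "j - 1"] ends by (auto simp: t_def)
  have le_t: "\<alpha> j \<le> t (Suc j)" if "j \<le> \<nu>" for j
    using that \<xi>[of j] ends by (cases "j = \<nu>") (auto simp: t_def)
  have "ennreal (\<Sum>j<Suc \<nu>. \<bar>f (t (Suc j)) - f (t j)\<bar>) \<le> total_variation a b f"
  proof (rule sum_le_total_variation)
    show "t j \<le> t (Suc j)" if "j < Suc \<nu>" for j
      using t_le[of j] le_t[of j] that by simp
  qed (auto simp: t_def)
  then have var: "(\<Sum>j<Suc \<nu>. \<bar>f (t (Suc j)) - f (t j)\<bar>) \<le> V"
    using V by (metis ennreal_le_iff order_trans)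
  have h\<alpha>: "\<bar>h (\<alpha> j)\<bar> \<le> c" if "j \<le> \<nu>" for j
    using h is_division_bounds[OF div that] by blast
  have c: "c \<ge> 0" using h\<alpha>[of 0] by linarith
  have "S_sum f h \<nu> \<alpha> \<xi> = (\<Sum>j<\<nu>. f (t (Suc j)) * (h (\<alpha> (Suc j)) - h (\<alpha> j)))"
    by (auto simp: S_sum_def sum.atLeast1_atMost_eq t_def intro!: sum.cong)
  also have "\<dots> = f b * h (\<alpha> \<nu>) - f a * h (\<alpha> 0)
      - (\<Sum>j<Suc \<nu>. h (\<alpha> j) * (f (t (Suc j)) - f (t j)))"
    using summation_by_parts_tags[of "f \<circ> t" "h \<circ> \<alpha>" \<nu>] by (simp add: t_def)
  finally have "\<bar>S_sum f h \<nu> \<alpha> \<xi>\<bar> \<le> \<bar>f b * h (\<alpha> \<nu>)\<bar> + \<bar>f a * h (\<alpha> 0)\<bar>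
      + \<bar>\<Sum>j<Suc \<nu>. h (\<alpha> j) * (f (t (Suc j)) - f (t j))\<bar>"
    by linarith
  also have "\<dots> \<le> \<bar>f b\<bar> * c + \<bar>f a\<bar> * c + c * V"
  proof (intro add_mono)
    have "\<bar>\<Sum>j<Suc \<nu>. h (\<alpha> j) * (f (t (Suc j)) - f (t j))\<bar>
        \<le> (\<Sum>j<Suc \<nu>. \<bar>h (\<alpha> j) * (f (t (Suc j)) - f (t j))\<bar>)"
      by (rule sum_abs)
    also have "\<dots> \<le> (\<Sum>j<Suc \<nu>. c * \<bar>f (t (Suc j)) - f (t j)\<bar>)"
      using h\<alpha> by (intro sum_mono) (auto simp: abs_mult intro!: mult_right_mono)
    also have "\<dots> \<le> c * V"
      unfolding sum_distrib_left[symmetric] using var c by (rule mult_left_mono)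
    finally show "\<bar>\<Sum>j<Suc \<nu>. h (\<alpha> j) * (f (t (Suc j)) - f (t j))\<bar> \<le> c * V" .
  qed (use h\<alpha> in \<open>auto simp: abs_mult intro!: mult_left_mono\<close>)
  finally show ?thesis by (simp add: algebra_simps)
qed

lemma S_sum_bound_small_variation:
  assumes P: "is_partition a b \<nu> \<alpha> \<xi>"
    and f: "\<And>x. x \<in> {a..b} \<Longrightarrow> \<bar>f x\<bar> \<le> M" "M \<ge> 0"
    and V: "total_variation a b h \<le> ennreal V" "V \<ge> 0"
  shows "\<bar>S_sum f h \<nu> \<alpha> \<xi>\<bar> \<le> M * V"
proof -
  have div: "is_division a b \<nu> \<alpha>" using P by (simp add: is_partition_def)
  have f\<xi>: "\<bar>f (\<xi> j)\<bar> \<le> M" if "j \<in> {1..\<nu>}" for j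
  proof (rule f(1))
    have "\<xi> j \<in> {\<alpha> (j - 1)..\<alpha> j}" using P that by (auto simp: is_partition_def)
    then show "\<xi> j \<in> {a..b}"
      using that is_division_bounds[OF div, of j] is_division_bounds[OF div, of "j - 1"] by force
  qed
  have "ennreal (\<Sum>j=1..\<nu>. \<bar>h (\<alpha> j) - h (\<alpha> (j - 1))\<bar>) \<le> total_variation a b h"
    unfolding total_variation_def using div by (intro Sup_upper) auto
  then have var: "(\<Sum>j=1..\<nu>. \<bar>h (\<alpha> j) - h (\<alpha> (j - 1))\<bar>) \<le> V"
    using V by (metis ennreal_le_iff order_trans)
  have "\<bar>S_sum f h \<nu> \<alpha> \<xi>\<bar> \<le> (\<Sum>j=1..\<nu>. \<bar>f (\<xi> j) * (h (\<alpha> j) - h (\<alpha> (j - 1)))\<bar>)"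
    unfolding S_sum_def by (rule sum_abs)
  also have "\<dots> \<le> (\<Sum>j=1..\<nu>. M * \<bar>h (\<alpha> j) - h (\<alpha> (j - 1))\<bar>)"
    using f\<xi> by (intro sum_mono) (auto simp: abs_mult intro!: mult_right_mono)
  also have "\<dots> \<le> M * V"
    unfolding sum_distrib_left[symmetric] using var f(2) by (rule mult_left_mono)
  finally show ?thesis .
qed

text \<open>The chain \<open>a, x, b\<close> suffices. The purpose is to obtain uniform closeness,
  up to a constant, from small variation.\<close>

lemma oscillation_le_total_variation:
  assumes "x \<in> {a..b}" "total_variation a b h \<le> ennreal V" "V \<ge> 0"
  shows "\<bar>h x - h a\<bar> \<le> V"
proof -
  define t where "t j = (if j = 0 then a else if j = 1 then x else b)" for j :: nat
  have "ennreal (\<Sum>j<2. \<bar>h (t (Suc j)) - h (t j)\<bar>) \<le> total_variation a b h"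
    by (rule sum_le_total_variation) (use assms in \<open>auto simp: t_def\<close>)
  then have "(\<Sum>j<2. \<bar>h (t (Suc j)) - h (t j)\<bar>) \<le> V"
    using assms by (metis ennreal_le_iff order_trans)
  then show ?thesis by (simp add: t_def numeral_2_eq_2)
qed

lemma S_sum_diff:
  "S_sum f g \<nu> \<alpha> \<xi> - S_sum f g' \<nu> \<alpha> \<xi> = S_sum f (\<lambda>x. g x - g' x) \<nu> \<alpha> \<xi>"
  by (simp add: S_sum_def sum_subtractf[symmetric] algebra_simps)

subsection \<open>Regulated functions and Young sums\<close>

text \<open>Existence of each one-sided limit of \<open>g\<close> is an instance of
  \<open>interchange_limits\<close> with \<open>F\<close> a one-sided neighbourhood filter; points
  of \<open>[a, b]\<close> suffice since \<open>F\<close> eventually stays there.\<close>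

lemma regulated_on_uniform_limit:
  assumes u: "\<And>n. regulated_on a b (u n)"
    and close: "\<And>e. e > 0 \<Longrightarrow> \<forall>\<^sub>F n in sequentially. \<forall>x\<in>{a..b}. \<bar>u n x - g x\<bar> \<le> e"
  shows "regulated_on a b g"
proof -
  have lim: "\<exists>L. (g \<longlongrightarrow> L) F"
    if F: "F \<noteq> bot" "\<forall>\<^sub>F x in F. x \<in> {a..b}" "\<And>n. \<exists>l. (u n \<longlongrightarrow> l) F" for F
  proof -
    obtain l where l: "\<And>n. (u n \<longlongrightarrow> l n) F" using F(3) by metis
    have "\<forall>\<^sub>F n in sequentially. \<forall>\<^sub>F x in F. dist (u n x) (g x) \<le> e" if "e > 0" for e
      using close[OF that]
    proof eventually_elim
      case (elim n)
      from F(2) show ?case by eventually_elim (use elim in \<open>auto simp: dist_real_def\<close>)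
    qed
    from interchange_limits[OF F(1) l this] show ?thesis by blast
  qed
  show ?thesis
    unfolding regulated_on_def
  proof (intro conjI ballI)
    fix t assume t: "t \<in> {a<..b}"
    show "\<exists>l. (g \<longlongrightarrow> l) (at_left t)"
    proof (rule lim)
      have "\<forall>\<^sub>F x in at_left t. x \<in> {a<..<t}" using t by (intro eventually_at_left_real) auto
      then show "\<forall>\<^sub>F x in at_left t. x \<in> {a..b}" by eventually_elim (use t in auto)
    qed (use t u in \<open>auto simp: regulated_on_def\<close>)
  next
    fix s assume s: "s \<in> {a..<b}"
    show "\<exists>l. (g \<longlongrightarrow> l) (at_right s)"
    proof (rule lim)
      have "\<forall>\<^sub>F x in at_right s. x \<in> {s<..<b}" using s by (intro eventually_at_right_real) auto
      then show "\<forall>\<^sub>F x in at_right s. x \<in> {a..b}" by eventually_elim (use s in auto)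
    qed (use s u in \<open>auto simp: regulated_on_def\<close>)
  qed
qed

lemma regulated_on_diff_const:
  "regulated_on a b h \<Longrightarrow> regulated_on a b (\<lambda>x. h x - c)"
proof -
  have "\<exists>l. ((\<lambda>x. h x - c) \<longlongrightarrow> l) F" if "\<exists>l. (h \<longlongrightarrow> l) F" for F
    using that tendsto_diff[OF _ tendsto_const] by blast
  then show "regulated_on a b h \<Longrightarrow> regulated_on a b (\<lambda>x. h x - c)"
    unfolding regulated_on_def by blast
qed

text \<open>One-sided limits at different points are rewritten as limits in one variable
  \<open>\<eta>\<close> tending to \<open>0\<close> from the right, so that all terms of a Young sum
  can converge along a single filter.\<close>

lemma tendsto_left_lim:
  assumes "regulated_on a b h" "t \<in> {a<..b}"
  shows "((\<lambda>\<eta>. h (t - \<eta>)) \<longlongrightarrow> left_lim h t) (at_right 0)"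
proof -
  obtain l where l: "(h \<longlongrightarrow> l) (at_left t)"
    using assms unfolding regulated_on_def by blast
  then have "left_lim h t = l" unfolding left_lim_def by (intro tendsto_Lim) auto
  with l have "((\<lambda>x. h (- x)) \<longlongrightarrow> left_lim h t) (at_right (- t))"
    by (simp add: filterlim_at_left_to_right)
  then show ?thesis by (subst (asm) filterlim_at_right_to_0) (simp add: algebra_simps)
qed

lemma tendsto_right_lim:
  assumes "regulated_on a b h" "s \<in> {a..<b}"
  shows "((\<lambda>\<eta>. h (s + \<eta>)) \<longlongrightarrow> right_lim h s) (at_right 0)"
proof -
  obtain l where l: "(h \<longlongrightarrow> l) (at_right s)"
    using assms unfolding regulated_on_def by blast
  then have "right_lim h s = l" unfolding right_lim_def by (intro tendsto_Lim) auto
  with l show ?thesis by (simp add: filterlim_at_right_to_0[of _ _ s] add.commute)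
qed

text \<open>
  The Young sum is the limit, as \<open>\<eta> \<rightarrow> 0+\<close>, of the ordinary sums of the partition in which each
  \<open>[\<alpha> (j - 1), \<alpha> j]\<close> is split at \<open>\<alpha> (j - 1) + \<eta>\<close> and \<open>\<alpha> j - \<eta>\<close>, with tags
  \<open>\<alpha> (j - 1), \<xi> j, \<alpha> j\<close>. Hence uniform bounds on ordinary sums carry over to Young sums.
\<close>

definition split_sum ::
  "(real \<Rightarrow> real) \<Rightarrow> (real \<Rightarrow> real) \<Rightarrow> nat \<Rightarrow> (nat \<Rightarrow> real) \<Rightarrow> (nat \<Rightarrow> real) \<Rightarrow> real \<Rightarrow> real" where
  "split_sum f g \<nu> \<alpha> \<xi> \<eta> =
     (\<Sum>j=1..\<nu>. f (\<alpha> (j - 1)) * (g (\<alpha> (j - 1) + \<eta>) - g (\<alpha> (j - 1)))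
              + f (\<xi> j) * (g (\<alpha> j - \<eta>) - g (\<alpha> (j - 1) + \<eta>))
              + f (\<alpha> j) * (g (\<alpha> j) - g (\<alpha> j - \<eta>)))"

lemma split_sum_tendsto_SY_sum:
  assumes "regulated_on a b g" "is_division a b \<nu> \<alpha>"
  shows "(split_sum f g \<nu> \<alpha> \<xi> \<longlongrightarrow> SY_sum f g \<nu> \<alpha> \<xi>) (at_right 0)"
proof -
  have "\<alpha> (j - 1) \<in> {a..<b} \<and> \<alpha> j \<in> {a<..b}" if "j \<in> {1..\<nu>}" for j
  proof -
    have "\<alpha> (j - 1) < \<alpha> j" using assms(2) that by (auto simp: is_division_def)
    then show ?thesis
      using that is_division_bounds[OF assms(2), of j] is_division_bounds[OF assms(2), of "j - 1"]
      by force
  qed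
  then show ?thesis
    unfolding split_sum_def SY_sum_def left_jump_def right_jump_def
    by (intro tendsto_intros tendsto_left_lim[OF assms(1)] tendsto_right_lim[OF assms(1)]) auto
qed

text \<open>The quantifier over \<open>g\<close> stands inside: one partition serves all
  integrators, so a bound on the difference of two ordinary sums applies to the two split
  sums.\<close>

lemma split_sum_eq_S_sum:
  assumes div: "is_division a b \<nu> \<alpha>"
    and "\<eta> > 0" and \<xi>: "\<And>j. j \<in> {1..\<nu>} \<Longrightarrow> \<alpha> (j - 1) + \<eta> < \<xi> j \<and> \<xi> j < \<alpha> j - \<eta>"
  shows "\<exists>\<mu> \<beta> \<zeta>. is_partition a b \<mu> \<beta> \<zeta> \<and> (\<forall>g. S_sum f g \<mu> \<beta> \<zeta> = split_sum f g \<nu> \<alpha> \<xi> \<eta>)"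
proof -
  have ext: "\<exists>\<mu> \<beta> \<zeta>. is_partition a d \<mu> \<beta> \<zeta> \<and> (\<forall>g. S_sum f g \<mu> \<beta> \<zeta> = S g + f s * (g d - g c))"
    if "\<exists>\<mu> \<beta> \<zeta>. is_partition a c \<mu> \<beta> \<zeta> \<and> (\<forall>g. S_sum f g \<mu> \<beta> \<zeta> = S g)" "c < d" "s \<in> {c..d}"
    for S c d s
    using that is_partition_extend S_sum_extend by metis
  have "\<exists>\<mu> \<beta> \<zeta>. is_partition a (\<alpha> m) \<mu> \<beta> \<zeta> \<and> (\<forall>g. S_sum f g \<mu> \<beta> \<zeta> = split_sum f g m \<alpha> \<xi> \<eta>)"
    if "m \<le> \<nu>" for m
    using that
  proof (induction m)
    case 0
    have "is_partition a (\<alpha> 0) 0 \<alpha> \<xi>" using div by (simp add: is_partition_def is_division_def)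
    then show ?case by (force simp: S_sum_def split_sum_def)
  next
    case (Suc m)
    have *: "\<alpha> m + \<eta> < \<xi> (Suc m)" "\<xi> (Suc m) < \<alpha> (Suc m) - \<eta>"
      using \<xi>[of "Suc m"] Suc.prems by auto
    have "\<exists>\<mu> \<beta> \<zeta>. is_partition a (\<alpha> m) \<mu> \<beta> \<zeta> \<and> (\<forall>g. S_sum f g \<mu> \<beta> \<zeta> = split_sum f g m \<alpha> \<xi> \<eta>)"
      using Suc by simp
    from ext[OF ext[OF ext[OF this, of "\<alpha> m + \<eta>" "\<alpha> m"], of "\<alpha> (Suc m) - \<eta>" "\<xi> (Suc m)"],
        of "\<alpha> (Suc m)" "\<alpha> (Suc m)"]
    show ?case using * \<open>\<eta> > 0\<close> by (simp add: split_sum_def add.assoc)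
  qed
  from this[of \<nu>] div show ?thesis by (simp add: is_division_def)
qed

lemma SY_sum_diff_bound:
  assumes g: "regulated_on a b g" "regulated_on a b g'"
    and P: "is_partition a b \<nu> \<alpha> \<xi>" "\<And>j. j \<in> {1..\<nu>} \<Longrightarrow> \<alpha> (j - 1) < \<xi> j \<and> \<xi> j < \<alpha> j"
    and S: "\<And>\<nu> \<alpha> \<xi>. is_partition a b \<nu> \<alpha> \<xi> \<Longrightarrow> \<bar>S_sum f g \<nu> \<alpha> \<xi> - S_sum f g' \<nu> \<alpha> \<xi>\<bar> \<le> e"
  shows "\<bar>SY_sum f g \<nu> \<alpha> \<xi> - SY_sum f g' \<nu> \<alpha> \<xi>\<bar> \<le> e"
proof -
  have div: "is_division a b \<nu> \<alpha>" using P(1) by (simp add: is_partition_def)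
  \<comment> \<open>For small \<open>\<eta>\<close> the splitting points lie on the correct sides of
    all tags. This uses that the tags are interior and finite in number.\<close>
  have "\<forall>\<^sub>F \<eta> in at_right 0. \<forall>j\<in>{1..\<nu>}. \<eta> < min (\<xi> j - \<alpha> (j - 1)) (\<alpha> j - \<xi> j)"
  proof (rule eventually_ball_finite)
    show "\<forall>j\<in>{1..\<nu>}. \<forall>\<^sub>F \<eta> in at_right 0. \<eta> < min (\<xi> j - \<alpha> (j - 1)) (\<alpha> j - \<xi> j)"
      using P(2) by (intro ballI order_tendstoD(2)[OF tendsto_ident_at]) simp
  qed simp
  moreover have "\<forall>\<^sub>F \<eta> in at_right 0. (0::real) < \<eta>" by (rule eventually_at_right_less)
  ultimately have "\<forall>\<^sub>F \<eta> in at_right 0. \<bar>split_sum f g \<nu> \<alpha> \<xi> \<eta> - split_sum f g' \<nu> \<alpha> \<xi> \<eta>\<bar> \<le> e"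
  proof eventually_elim
    case (elim \<eta>)
    then have "\<exists>\<mu> \<beta> \<zeta>. is_partition a b \<mu> \<beta> \<zeta> \<and> (\<forall>g. S_sum f g \<mu> \<beta> \<zeta> = split_sum f g \<nu> \<alpha> \<xi> \<eta>)"
      by (intro split_sum_eq_S_sum[OF div]) force+
    then show ?case using S by metis
  qed
  moreover have "((\<lambda>\<eta>. \<bar>split_sum f g \<nu> \<alpha> \<xi> \<eta> - split_sum f g' \<nu> \<alpha> \<xi> \<eta>\<bar>) \<longlongrightarrow>
      \<bar>SY_sum f g \<nu> \<alpha> \<xi> - SY_sum f g' \<nu> \<alpha> \<xi>\<bar>) (at_right 0)"
    by (intro tendsto_intros split_sum_tendsto_SY_sum[OF _ div] g)
  ultimately show ?thesis by (intro tendsto_upperbound) auto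
qed

subsection \<open>Integrals as limits along filters of partitions\<close>

type_synonym partition_data = "nat \<times> (nat \<Rightarrow> real) \<times> (nat \<Rightarrow> real)"

definition fine_partitions :: "real \<Rightarrow> real \<Rightarrow> (real \<Rightarrow> real) \<Rightarrow> partition_data set" where
  "fine_partitions a b \<delta> = {(\<nu>, \<alpha>, \<xi>). is_partition a b \<nu> \<alpha> \<xi> \<and>
     (\<forall>j\<in>{1..\<nu>}. {\<alpha> (j - 1)..\<alpha> j} \<subseteq> {\<xi> j - \<delta> (\<xi> j)..\<xi> j + \<delta> (\<xi> j)})}"

definition gauges :: "real \<Rightarrow> real \<Rightarrow> (real \<Rightarrow> real) set" where
  "gauges a b = {\<delta>. \<forall>t\<in>{a..b}. 0 < \<delta> t \<and> \<delta> t < 1}"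

definition refining_partitions :: "real \<Rightarrow> real \<Rightarrow> nat \<times> (nat \<Rightarrow> real) \<Rightarrow> partition_data set" where
  "refining_partitions a b = (\<lambda>(\<mu>, \<beta>). {(\<nu>, \<alpha>, \<xi>). is_partition a b \<nu> \<alpha> \<xi> \<and>
     division_points \<mu> \<beta> \<subseteq> division_points \<nu> \<alpha> \<and>
     (\<forall>j\<in>{1..\<nu>}. \<alpha> (j - 1) < \<xi> j \<and> \<xi> j < \<alpha> j)})"

definition divisions :: "real \<Rightarrow> real \<Rightarrow> (nat \<times> (nat \<Rightarrow> real)) set" where
  "divisions a b = {(\<mu>, \<beta>). is_division a b \<mu> \<beta>}"

text \<open>Young and Dushnik integrals share the refinement filter and differ in the sums; Kurzweil
  and Dushnik integrals share the sums and differ in the filter.\<close>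

definition partition_filter :: "integral_kind \<Rightarrow> real \<Rightarrow> real \<Rightarrow> partition_data filter" where
  "partition_filter K a b =
     (if K = Kurzweil then INF \<delta>\<in>gauges a b. principal (fine_partitions a b \<delta>)
      else INF D\<in>divisions a b. principal (refining_partitions a b D))"

definition integral_sum ::
  "integral_kind \<Rightarrow> (real \<Rightarrow> real) \<Rightarrow> (real \<Rightarrow> real) \<Rightarrow> partition_data \<Rightarrow> real" where
  "integral_sum K f g = (\<lambda>(\<nu>, \<alpha>, \<xi>). if K = Young then SY_sum f g \<nu> \<alpha> \<xi> else S_sum f g \<nu> \<alpha> \<xi>)"

text \<open>
  Cousin's lemma. Bolzano's bisection principle is applied to the property that \<open>[a, y]\<close> has a fine
  partition whenever \<open>[a, x]\<close> has one, which is transitive for trivial reasons.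
\<close>

lemma fine_partitions_nonempty:
  assumes "a \<le> b" "\<delta> \<in> gauges a b"
  shows "fine_partitions a b \<delta> \<noteq> {}"
proof -
  define R where "R x \<longleftrightarrow> fine_partitions a x \<delta> \<noteq> {}" for x
  have "R a \<longrightarrow> R b"
    using assms(1)
  proof (induction rule: Bolzano)
    case (local x)
    \<comment> \<open>The subinterval \<open>[p, q]\<close> contains \<open>x\<close> and is shorter
      than \<open>\<delta> x\<close>, so \<open>x\<close> is an admissible tag for it. The case
      \<open>p = q\<close> is separate because divisions are strict.\<close>
    have "R p \<Longrightarrow> R q" if pq: "p \<le> x" "x \<le> q" "q - p < \<delta> x" for p q
    proof (cases "p = q")
      case False
      assume "R p"
      then obtain \<nu> \<alpha> \<xi> where P: "is_partition a p \<nu> \<alpha> \<xi>"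
        and fine: "\<forall>j\<in>{1..\<nu>}. {\<alpha> (j - 1)..\<alpha> j} \<subseteq> {\<xi> j - \<delta> (\<xi> j)..\<xi> j + \<delta> (\<xi> j)}"
        by (auto simp: R_def fine_partitions_def)
      let ?\<alpha> = "\<alpha>(Suc \<nu> := q)" and ?\<xi> = "\<xi>(Suc \<nu> := x)"
      have "\<alpha> \<nu> = p" using P by (simp add: is_partition_def is_division_def)
      then have "{?\<alpha> (j - 1)..?\<alpha> j} \<subseteq> {?\<xi> j - \<delta> (?\<xi> j)..?\<xi> j + \<delta> (?\<xi> j)}" if "j \<in> {1..Suc \<nu>}" for j
        using that fine pq by (cases "j = Suc \<nu>") auto
      moreover have "is_partition a q (Suc \<nu>) ?\<alpha> ?\<xi>"
        using pq False by (intro is_partition_extend[OF P]) auto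
      ultimately have "(Suc \<nu>, ?\<alpha>, ?\<xi>) \<in> fine_partitions a q \<delta>"
        unfolding fine_partitions_def by blast
      then show "R q" unfolding R_def by blast
    qed simp
    moreover have "\<delta> x > 0" using assms(2) local by (auto simp: gauges_def)
    ultimately show ?case by blast
  qed simp
  moreover have "(0, \<lambda>_. a, \<lambda>_. a) \<in> fine_partitions a a \<delta>"
    by (simp add: fine_partitions_def is_partition_def is_division_def)
  ultimately show ?thesis unfolding R_def by blast
qed

lemma refining_partitions_nonempty:
  assumes "D \<in> divisions a b"
  shows "refining_partitions a b D \<noteq> {}"
proof -
  obtain \<mu> \<beta> where D: "D = (\<mu>, \<beta>)" "is_division a b \<mu> \<beta>" using assms by (auto simp: divisions_def)
  have "\<beta> (j - 1) < \<beta> j" if "j \<in> {1..\<mu>}" for j using D(2) that by (auto simp: is_division_def)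
  then have "(\<mu>, \<beta>, \<lambda>j. (\<beta> (j - 1) + \<beta> j) / 2) \<in> refining_partitions a b D"
    using D by (simp add: refining_partitions_def is_partition_def field_simps less_imp_le)
  then show ?thesis by blast
qed

text \<open>The pointwise minimum works. Directedness makes the principal filters a base, so that
  \<open>eventually\<close> is witnessed by a single gauge, as in the definition of the
  integral.\<close>

lemma gauges_directed:
  assumes "\<delta> \<in> gauges a b" "\<delta>' \<in> gauges a b"
  shows "\<exists>\<gamma>\<in>gauges a b. principal (fine_partitions a b \<gamma>)
    \<le> inf (principal (fine_partitions a b \<delta>)) (principal (fine_partitions a b \<delta>'))"
proof (rule bexI)
  have "{\<xi> - min (\<delta> \<xi>) (\<delta>' \<xi>)..\<xi> + min (\<delta> \<xi>) (\<delta>' \<xi>)}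
      = {\<xi> - \<delta> \<xi>..\<xi> + \<delta> \<xi>} \<inter> {\<xi> - \<delta>' \<xi>..\<xi> + \<delta>' \<xi>}" for \<xi>
    by auto
  then show "principal (fine_partitions a b (\<lambda>t. min (\<delta> t) (\<delta>' t)))
    \<le> inf (principal (fine_partitions a b \<delta>)) (principal (fine_partitions a b \<delta>'))"
    by (auto simp: fine_partitions_def)
  show "(\<lambda>t. min (\<delta> t) (\<delta>' t)) \<in> gauges a b"
    using assms by (auto simp: gauges_def min_def)
qed

lemma divisions_directed:
  assumes "D \<in> divisions a b" "D' \<in> divisions a b" "a \<le> b"
  shows "\<exists>E\<in>divisions a b. principal (refining_partitions a b E)
    \<le> inf (principal (refining_partitions a b D)) (principal (refining_partitions a b D'))"
proof -
  obtain \<mu> \<beta> \<mu>' \<beta>' where D: "D = (\<mu>, \<beta>)" "is_division a b \<mu> \<beta>" "D' = (\<mu>', \<beta>')" "is_division a b \<mu>' \<beta>'"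
    using assms by (auto simp: divisions_def)
  have "division_points \<mu> \<beta> \<union> division_points \<mu>' \<beta>' \<subseteq> {a..b}"
    using is_division_bounds[OF D(2)] is_division_bounds[OF D(4)] by (auto simp: division_points_def)
  then have "\<exists>\<nu> \<alpha>. is_division a b \<nu> \<alpha> \<and>
      division_points \<mu> \<beta> \<union> division_points \<mu>' \<beta>' \<subseteq> division_points \<nu> \<alpha>"
    using assms(3) by (intro division_through_finite_set) (auto simp: division_points_def)
  then obtain \<nu> \<alpha> where E: "is_division a b \<nu> \<alpha>"
    "division_points \<mu> \<beta> \<union> division_points \<mu>' \<beta>' \<subseteq> division_points \<nu> \<alpha>" by blast
  show ?thesis
  proof (rule bexI)
    show "principal (refining_partitions a b (\<nu>, \<alpha>))
      \<le> inf (principal (refining_partitions a b D)) (principal (refining_partitions a b D'))"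
      using E(2) D by (auto simp: refining_partitions_def)
    show "(\<nu>, \<alpha>) \<in> divisions a b" using E(1) by (simp add: divisions_def)
  qed
qed

lemma gauges_nonempty: "gauges a b \<noteq> {}"
proof -
  have "(\<lambda>_. 1 / 2) \<in> gauges a b" by (simp add: gauges_def)
  then show ?thesis by blast
qed

lemma divisions_nonempty: "a \<le> b \<Longrightarrow> divisions a b \<noteq> {}"
  using division_through_finite_set[of "{}" a b] by (auto simp: divisions_def)

lemma eventually_partition_filter:
  assumes "a \<le> b"
  shows "eventually Q (partition_filter K a b) \<longleftrightarrow>
    (if K = Kurzweil then \<exists>\<delta>\<in>gauges a b. \<forall>p\<in>fine_partitions a b \<delta>. Q p
     else \<exists>D\<in>divisions a b. \<forall>p\<in>refining_partitions a b D. Q p)"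
  unfolding partition_filter_def
  by (auto simp: eventually_INF_base[OF gauges_nonempty gauges_directed] eventually_principal
      eventually_INF_base[OF divisions_nonempty divisions_directed] assms)

text \<open>Properness, which rests on Cousin's lemma in the Kurzweil case, gives both uniqueness of
  the integral and the Cauchy property of the sequence of integrals.\<close>

lemma partition_filter_neq_bot:
  assumes "a \<le> b"
  shows "partition_filter K a b \<noteq> bot"
  unfolding trivial_limit_def eventually_partition_filter[OF assms]
  using fine_partitions_nonempty[OF assms] refining_partitions_nonempty
  by (simp add: ex_in_conv del: split_paired_All split_paired_Ex)

lemma eventually_is_partition:
  assumes "a \<le> b"
  shows "\<forall>\<^sub>F (\<nu>, \<alpha>, \<xi>) in partition_filter K a b. is_partition a b \<nu> \<alpha> \<xi> \<and>
    (K \<noteq> Kurzweil \<longrightarrow> (\<forall>j\<in>{1..\<nu>}. \<alpha> (j - 1) < \<xi> j \<and> \<xi> j < \<alpha> j))"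
  unfolding eventually_partition_filter[OF assms]
  using gauges_nonempty[of a b] divisions_nonempty[OF assms]
  by (auto simp: fine_partitions_def refining_partitions_def)

lemma has_stieltjes_integral_iff_tendsto:
  assumes "a \<le> b"
  shows "has_stieltjes_integral K a b f g I \<longleftrightarrow>
    (K = Young \<longrightarrow> regulated_on a b g) \<and> (integral_sum K f g \<longlongrightarrow> I) (partition_filter K a b)"
  unfolding tendsto_iff eventually_partition_filter[OF assms]
  by (cases K) (simp_all add: has_Kurzweil_integral_def has_Young_integral_def
      has_Dushnik_integral_def gauges_def divisions_def fine_partitions_def refining_partitions_def
      integral_sum_def dist_real_def Bex_def Ball_def)

lemma stieltjes_integral_eq:
  assumes "a \<le> b" "has_stieltjes_integral K a b f g I"
  shows "stieltjes_integral K a b f g = I"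
  unfolding stieltjes_integral_def
  using assms tendsto_unique[OF partition_filter_neq_bot]
  by (intro the_equality) (auto simp: has_stieltjes_integral_iff_tendsto)

subsection \<open>The convergence theorem\<close>

text \<open>The common core of both cases. The assumption \<open>reg\<close> is an implication
  because only the Young integral includes regularity of the integrators in its definition.\<close>

lemma stieltjes_integral_limit:
  assumes ab: "a \<le> b"
    and int: "\<And>n. stieltjes_integrable K a b f (gn n)"
    and S: "\<And>e. e > 0 \<Longrightarrow> \<forall>\<^sub>F n in sequentially. \<forall>\<nu> \<alpha> \<xi>. is_partition a b \<nu> \<alpha> \<xi> \<longrightarrow>
        \<bar>S_sum f (gn n) \<nu> \<alpha> \<xi> - S_sum f g \<nu> \<alpha> \<xi>\<bar> \<le> e"
    and reg: "(\<And>n. regulated_on a b (gn n)) \<Longrightarrow> regulated_on a b g"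
  shows "stieltjes_integrable K a b f g \<and>
    (\<lambda>n. stieltjes_integral K a b f (gn n)) \<longlonglongrightarrow> stieltjes_integral K a b f g"
proof -
  let ?F = "partition_filter K a b"
  obtain l where l: "\<And>n. has_stieltjes_integral K a b f (gn n) (l n)"
    using int unfolding stieltjes_integrable_def by metis
  have lims: "(integral_sum K f (gn n) \<longlongrightarrow> l n) ?F" "K = Young \<Longrightarrow> regulated_on a b (gn n)" for n
    using l[of n] by (auto simp: has_stieltjes_integral_iff_tendsto[OF ab])
  have g: "regulated_on a b g" if "K = Young" by (rule reg) (rule lims(2)[OF that])
  have "\<forall>\<^sub>F n in sequentially. \<forall>\<^sub>F p in ?F. dist (integral_sum K f (gn n) p) (integral_sum K f g p) \<le> e"
    if "e > 0" for e
    using S[OF that]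
  proof eventually_elim
    case n: (elim n)
    show ?case
      using eventually_is_partition[OF ab, of K]
    proof eventually_elim
      case (elim p)
      obtain \<nu> \<alpha> \<xi> where p: "p = (\<nu>, \<alpha>, \<xi>)" by (cases p)
      show ?case
      proof (cases "K = Young")
        case True
        have "\<bar>SY_sum f (gn n) \<nu> \<alpha> \<xi> - SY_sum f g \<nu> \<alpha> \<xi>\<bar> \<le> e"
          using elim p True n
          by (intro SY_sum_diff_bound[OF lims(2)[OF True] g[OF True]]) auto
        then show ?thesis using True p by (simp add: integral_sum_def dist_real_def)
      next
        case False
        then show ?thesis
          using elim p n by (simp add: integral_sum_def dist_real_def)
      qed
    qed
  qed
  from interchange_limits[OF partition_filter_neq_bot[OF ab] lims(1) this]
  obtain L where L: "l \<longlonglongrightarrow> L" "(integral_sum K f g \<longlongrightarrow> L) ?F"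
    by blast
  have int_g: "has_stieltjes_integral K a b f g L"
    using L(2) g by (simp add: has_stieltjes_integral_iff_tendsto[OF ab])
  then have "stieltjes_integrable K a b f g" unfolding stieltjes_integrable_def by blast
  then show ?thesis
    using L(1) by (simp add: stieltjes_integral_eq[OF ab int_g] stieltjes_integral_eq[OF ab l])
qed

theorem theorem2p5:
  fixes K :: integral_kind
    and a b :: real
    and f g :: "real \<Rightarrow> real"
    and gn :: "nat \<Rightarrow> real \<Rightarrow> real"
  assumes "a < b"
    and "\<And>n. stieltjes_integrable K a b f (gn n)"
    and "(bounded_variation_on a b f \<and> uniform_limit {a..b} gn g sequentially) \<or>
         (bounded (f ` {a..b}) \<and>
          (\<lambda>n. total_variation a b (\<lambda>t. gn n t - g t)) \<longlonglongrightarrow> 0)"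
  shows "stieltjes_integrable K a b f g \<and>
         (\<lambda>n. stieltjes_integral K a b f (gn n)) \<longlonglongrightarrow> stieltjes_integral K a b f g"
proof (rule stieltjes_integral_limit)
  show "a \<le> b" using assms(1) by simp
  show "stieltjes_integrable K a b f (gn n)" for n by (rule assms(2))
  consider (bv) "bounded_variation_on a b f" "uniform_limit {a..b} gn g sequentially"
    | (var) "bounded (f ` {a..b})" "(\<lambda>n. total_variation a b (\<lambda>t. gn n t - g t)) \<longlonglongrightarrow> 0"
    using assms(3) by blast
  note cases = this
  have small_var: "\<forall>\<^sub>F n in sequentially. total_variation a b (\<lambda>t. gn n t - g t) \<le> ennreal e"
    if "(\<lambda>n. total_variation a b (\<lambda>t. gn n t - g t)) \<longlonglongrightarrow> 0" "e > 0" for e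
  proof -
    have "\<forall>\<^sub>F n in sequentially. total_variation a b (\<lambda>t. gn n t - g t) < ennreal e"
      using order_tendstoD(2)[OF that(1), of "ennreal e"] that(2) by simp
    then show ?thesis by eventually_elim (rule less_imp_le)
  qed
  have small_unif: "\<forall>\<^sub>F n in sequentially. \<forall>x\<in>{a..b}. \<bar>gn n x - g x\<bar> \<le> e"
    if "uniform_limit {a..b} gn g sequentially" "e > 0" for e
    using uniform_limitD[OF that]
    by eventually_elim (auto simp: dist_real_def intro: less_imp_le)
  show "\<forall>\<^sub>F n in sequentially. \<forall>\<nu> \<alpha> \<xi>. is_partition a b \<nu> \<alpha> \<xi> \<longrightarrow>
      \<bar>S_sum f (gn n) \<nu> \<alpha> \<xi> - S_sum f g \<nu> \<alpha> \<xi>\<bar> \<le> e" if "e > 0" for e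
    using cases
  proof cases
    case bv
    obtain V where V: "total_variation a b f \<le> ennreal V" "V \<ge> 0"
      using bv(1) unfolding bounded_variation_on_def
      by (cases "total_variation a b f") auto
    \<comment> \<open>Adding \<open>1\<close> keeps the divisor in \<open>e / C\<close> positive
      even if \<open>f\<close> vanishes.\<close>
    define C where "C = \<bar>f a\<bar> + \<bar>f b\<bar> + V + 1"
    have C: "C > 0" "\<bar>f a\<bar> + \<bar>f b\<bar> + V \<le> C" using V(2) by (auto simp: C_def)
    have "\<forall>\<^sub>F n in sequentially. \<forall>x\<in>{a..b}. \<bar>gn n x - g x\<bar> \<le> e / C"
      using small_unif[OF bv(2)] C that by simp
    then show ?thesis
    proof (eventually_elim, intro allI impI)
      fix n \<nu> \<alpha> \<xi>
      assume n: "\<forall>x\<in>{a..b}. \<bar>gn n x - g x\<bar> \<le> e / C" and P: "is_partition a b \<nu> \<alpha> \<xi>"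
      have "\<bar>S_sum f (\<lambda>x. gn n x - g x) \<nu> \<alpha> \<xi>\<bar> \<le> (\<bar>f a\<bar> + \<bar>f b\<bar> + V) * (e / C)"
        using n by (intro S_sum_bound_bounded_variation[OF P V]) auto
      also have "\<dots> \<le> C * (e / C)" using C that by (intro mult_right_mono) auto
      also have "\<dots> = e" using C by simp
      finally show "\<bar>S_sum f (gn n) \<nu> \<alpha> \<xi> - S_sum f g \<nu> \<alpha> \<xi>\<bar> \<le> e" by (simp add: S_sum_diff)
    qed
  next
    case var
    obtain M where M: "M > 0" "\<And>x. x \<in> {a..b} \<Longrightarrow> \<bar>f x\<bar> \<le> M"
      using var(1) by (auto simp: bounded_pos)
    have "\<forall>\<^sub>F n in sequentially. total_variation a b (\<lambda>t. gn n t - g t) \<le> ennreal (e / M)"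
      using small_var[OF var(2)] M that by simp
    then show ?thesis
    proof (eventually_elim, intro allI impI)
      fix n \<nu> \<alpha> \<xi>
      assume n: "total_variation a b (\<lambda>t. gn n t - g t) \<le> ennreal (e / M)"
        and P: "is_partition a b \<nu> \<alpha> \<xi>"
      have "\<bar>S_sum f (\<lambda>x. gn n x - g x) \<nu> \<alpha> \<xi>\<bar> \<le> M * (e / M)"
        using M that by (intro S_sum_bound_small_variation[OF P _ _ n]) auto
      then show "\<bar>S_sum f (gn n) \<nu> \<alpha> \<xi> - S_sum f g \<nu> \<alpha> \<xi>\<bar> \<le> e" using M by (simp add: S_sum_diff)
    qed
  qed
  show "regulated_on a b g" if reg: "\<And>n. regulated_on a b (gn n)"
    using cases
  proof cases
    case bv
    show ?thesis by (rule regulated_on_uniform_limit[OF reg small_unif[OF bv(2)]])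
  next
    case var
    text \<open>The variation does not see constants: only \<open>gn n - (gn n a - g a)\<close> tends to \<open>g\<close>.\<close>
    show ?thesis
    proof (rule regulated_on_uniform_limit)
      show "regulated_on a b (\<lambda>x. gn n x - (gn n a - g a))" for n
        by (rule regulated_on_diff_const[OF reg])
      show "\<forall>\<^sub>F n in sequentially. \<forall>x\<in>{a..b}. \<bar>gn n x - (gn n a - g a) - g x\<bar> \<le> e" if "e > 0" for e
        using small_var[OF var(2) that]
      proof (eventually_elim, intro ballI)
        fix n x assume "total_variation a b (\<lambda>t. gn n t - g t) \<le> ennreal e" "x \<in> {a..b}"
        then show "\<bar>gn n x - (gn n a - g a) - g x\<bar> \<le> e"
          using oscillation_le_total_variation[of x a b "\<lambda>t. gn n t - g t" e] that
          by (simp add: algebra_simps)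
      qed
    qed
  qed
qed

end
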